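(* Let $T\in\mathbb{R}^{q\times q}$ be a matrix such that (1) $|\langle \mathbf{e}_i, T(\mathbf{e}_j)\rangle - 1/q|\le 1/(2q)$ for all standard basis vectors $\mathbf{e}_i,\mathbf{e}_j$; and (2) $\epsilon := \max\{\|T\mathbf{1}-\mathbf{1}\|_\infty,\ \|T'\mathbf{1}-\mathbf{1}\|_\infty\}\le 1/(48\sqrt q)$. Let $D_1,D_2$ be diagonal matrices such that $D_2TD_1$ is doubly stochastic. Then $$\|D_2\otimes D_1-\mathsf{I}\|_2\le 96\sqrt q\,\epsilon.$$
   Context: $\mathbf{1}=(1,\dots,1)'\in\mathbb{R}^q$; prime denotes transpose; $\otimes$ is the Kronecker product, so $D_2\otimes D_1$ is an operator on the $q^2$-dimensional space $\mathbb{R}^{q\times q}$ and $\mathsf{I}$ is the identity on that space; $\|\cdot\|_2$ is the spectral (operator) norm. A matrix is doubly stochastic if it is entrywise nonnegative with all row and column sums equal to $1$. *)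

theory Defs
  imports "HOL-Analysis.Analysis"
begin

definition diagonal :: "real ^ 'n ^ 'n \<Rightarrow> bool" where
  "diagonal D \<longleftrightarrow> (\<forall>i j. i \<noteq> j \<longrightarrow> D $ i $ j = 0)"

definition doubly_stochastic :: "real ^ 'n ^ 'n \<Rightarrow> bool" where
  "doubly_stochastic A \<longleftrightarrow>
     (\<forall>i j. 0 \<le> A $ i $ j) \<and>
     (\<forall>i. (\<Sum>j\<in>UNIV. A $ i $ j) = 1) \<and>
     (\<forall>j. (\<Sum>i\<in>UNIV. A $ i $ j) = 1)"

(* The product acts on vectors indexed by pairs: reading such a vector as a matrix X with
   X i j = x $ (i, j), the map is X |-> A X B', the Kronecker product in row-major order. *)
definition kronecker :: "real ^ 'n ^ 'm \<Rightarrow> real ^ 'q ^ 'p \<Rightarrow> real ^ ('n \<times> 'q) ^ ('m \<times> 'p)"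
    (infixl "\<otimes>\<^sub>K" 70) where
  "A \<otimes>\<^sub>K B = (\<chi> r c. A $ fst r $ fst c * B $ snd r $ snd c)"

definition spectral_norm :: "real ^ 'n ^ 'm \<Rightarrow> real" where
  "spectral_norm A = onorm ((*v) A)"

end

theory Submission
  imports Defs
begin

text \<open>
  Write \<open>y\<close> and \<open>x\<close> for the diagonals of \<open>D\<^sub>2\<close> and \<open>D\<^sub>1\<close>, and \<open>q\<close> for the dimension. The matrix
  \<open>D\<^sub>2 \<otimes>\<^sub>K D\<^sub>1 - mat 1\<close> is diagonal with entries \<open>y\<^sub>i x\<^sub>j - 1\<close>, so it suffices to bound these. Since \<open>T\<close>
  has positive entries and the scaled matrix is nonnegative with nonzero rows and columns, all
  products \<open>y\<^sub>i x\<^sub>j\<close> are positive, so \<open>x\<close> and \<open>y\<close> may be replaced by their absolute values.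
  Double stochasticity then says that \<open>y\<close> is the entrywise inverse of \<open>T x\<close> and \<open>x\<close> that of \<open>T' y\<close>.

  The idea is that \<open>T\<close> and \<open>T'\<close> contract ratios of entries of positive vectors, as in the
  Birkhoff--Hopf theorem. Every entry of \<open>T\<close> is at least \<open>1 / (2 q)\<close>, so each row of \<open>T\<close> carries
  the constant \<open>1 / (2 q)\<close>, which has mass \<open>1/2\<close> and contributes the same to every entry
  of \<open>T x\<close>; only the remaining mass, about \<open>1/2\<close>, can tell entries apart. Hence entry ratios at
  most \<open>\<rho>\<close> in \<open>x\<close> become ratios at most \<open>(1 + \<rho> + 2 \<epsilon> \<rho>) / (2 - 2 \<epsilon>)\<close> in \<open>T x\<close>
  (\<open>entry_ratio_contraction\<close>), and inversion does not change this bound. Taking for \<open>\<rho>\<close> the largest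
  entry ratio in \<open>x\<close> and \<open>y\<close> together, \<open>\<rho>\<close> is bounded by its own image, which gives
  \<open>(1 - 4 \<epsilon>) \<rho> \<le> 1\<close> (\<open>scaling_entry_ratio\<close>). In particular \<open>x\<close> is nearly constant, and as the
  row sums of \<open>T\<close> are near \<open>1\<close>, all entries of \<open>T x\<close> are close to all entries of \<open>x\<close>. Now
  \<open>y\<^sub>i (T x)\<^sub>i = 1\<close> forces \<open>\<bar>y\<^sub>i x\<^sub>j - 1\<bar> \<le> 6 \<epsilon>\<close> (\<open>scaling_product_near_one\<close>). The dimension does not
  enter this bound; the factor \<open>sqrt q\<close> of the theorem comes in only through \<open>1 \<le> sqrt q\<close>.
\<close>

section \<open>Spectral norm of diagonal matrices\<close>

lemma spectral_norm_diagonal_le: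
  fixes A :: "real ^ 'm ^ 'm"
  assumes "diagonal A" and bound: "\<And>i. \<bar>A $ i $ i\<bar> \<le> c"
  shows "spectral_norm A \<le> c"
  unfolding spectral_norm_def
proof (rule onorm_le)
  fix v :: "real ^ 'm"
  have c: "0 \<le> c"
    using bound[of undefined] by linarith
  have entry: "(A *v v) $ i = A $ i $ i * v $ i" for i
  proof -
    have "(A *v v) $ i = (\<Sum>j\<in>UNIV. if j = i then A $ i $ i * v $ i else 0)"
      unfolding matrix_vector_mult_def vec_lambda_beta
      using \<open>diagonal A\<close> by (intro sum.cong) (auto simp: diagonal_def)
    then show ?thesis by simp
  qed
  have "norm (A *v v) \<le> norm (c *\<^sub>R v)"
    by (rule norm_le_componentwise_cart)
      (auto simp: entry abs_mult c bound intro!: mult_right_mono)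
  then show "norm (A *v v) \<le> c * norm v"
    using c by simp
qed

section \<open>Contraction of entry ratios\<close>

text \<open>
  Split each row of \<open>T\<close> into the constant \<open>1 / (2 q)\<close> and a nonnegative remainder of mass within
  \<open>\<epsilon>\<close> of \<open>1/2\<close>. The constant part adds one and the same number \<open>a\<close> to all entries of \<open>T x\<close>, and
  \<open>a\<close> is at least half the smallest entry \<open>m\<close> of \<open>x\<close>; the remainder adds something between
  \<open>(1/2 - \<epsilon>) m\<close> and \<open>(1/2 + \<epsilon>) \<rho> m\<close>. The ratio of the two resulting bounds decreases in \<open>a\<close>, so
  \<open>a = m / 2\<close> is the worst case.
\<close>

lemma entry_ratio_contraction:
  fixes T :: "real ^ 'n ^ 'n" and x :: "real ^ 'n"
  assumes lower: "\<And>i j. 1 / (2 * real CARD('n)) \<le> T $ i $ j"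
    and rows: "\<And>i. \<bar>(T *v 1) $ i - 1\<bar> \<le> \<epsilon>"
    and pos: "\<And>j. 0 < x $ j"
    and ratio: "\<And>j l. x $ j \<le> \<rho> * x $ l"
    and eps1: "\<epsilon> \<le> 1"
  shows "(2 - 2 * \<epsilon>) * (T *v x) $ i \<le> (1 + \<rho> + 2 * \<epsilon> * \<rho>) * (T *v x) $ k"
proof -
  define q where "q = real CARD('n)"
  define R where "R i j = T $ i $ j - 1 / (2 * q)" for i j
  define a where "a = (\<Sum>j\<in>UNIV. x $ j) / (2 * q)"
  have q: "0 < q" by (simp add: q_def)
  have R: "0 \<le> R i j" for i j
    using lower[of i j] by (simp add: R_def q_def)
  have eps: "0 \<le> \<epsilon>" using rows[of undefined] by linarith
  obtain l where l: "\<And>j. x $ l \<le> x $ j"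
  proof -
    have "Min (range (($) x)) \<in> range (($) x)" by (rule Min_in) auto
    then obtain l where "x $ l = Min (range (($) x))" by force
    then have "x $ l \<le> x $ j" for j by simp
    then show thesis by (rule that)
  qed
  define m where "m = x $ l"
  have m: "0 < m" by (simp add: m_def pos)
  have rho: "1 \<le> \<rho>"
    using ratio[of l l] pos[of l] by simp
  have a: "m / 2 \<le> a"
  proof -
    have "q * m = (\<Sum>j\<in>(UNIV :: 'n set). m)" by (simp add: q_def)
    also have "\<dots> \<le> (\<Sum>j\<in>UNIV. x $ j)" by (rule sum_mono) (simp add: m_def l)
    finally show ?thesis using q by (simp add: a_def field_simps)
  qed
  have split: "(T *v x) $ i = a + (\<Sum>j\<in>UNIV. R i j * x $ j)" for i
    by (simp add: matrix_vector_mult_def R_def a_def left_diff_distrib sum_subtractf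
        sum_divide_distrib)
  have mass: "(\<Sum>j\<in>UNIV. R i j) = (T *v 1) $ i - 1 / 2" for i
    using q by (simp add: matrix_vector_mult_def R_def sum_subtractf q_def)
  have upper: "(T *v x) $ i \<le> a + (1 / 2 + \<epsilon>) * (\<rho> * m)"
  proof -
    have "(\<Sum>j\<in>UNIV. R i j * x $ j) \<le> (\<Sum>j\<in>UNIV. R i j * (\<rho> * m))"
      by (intro sum_mono mult_left_mono R) (simp add: m_def ratio)
    also have "\<dots> = ((T *v 1) $ i - 1 / 2) * (\<rho> * m)"
      by (simp only: sum_distrib_right[symmetric] mass)
    also have "\<dots> \<le> (1 / 2 + \<epsilon>) * (\<rho> * m)"
      using rows[of i] m rho by (intro mult_right_mono) auto
    finally show ?thesis by (simp add: split)
  qed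
  have low: "a + (1 / 2 - \<epsilon>) * m \<le> (T *v x) $ k"
  proof -
    have "(1 / 2 - \<epsilon>) * m \<le> ((T *v 1) $ k - 1 / 2) * m"
      using rows[of k] m by (intro mult_right_mono) auto
    also have "\<dots> = (\<Sum>j\<in>UNIV. R k j * m)"
      by (simp only: sum_distrib_right[symmetric] mass)
    also have "\<dots> \<le> (\<Sum>j\<in>UNIV. R k j * x $ j)"
      by (intro sum_mono mult_left_mono R) (simp add: m_def l)
    finally show ?thesis by (simp add: split)
  qed
  have "(2 - 2 * \<epsilon>) * (T *v x) $ i \<le> (2 - 2 * \<epsilon>) * (a + (1 / 2 + \<epsilon>) * (\<rho> * m))"
    using upper eps1 by (intro mult_left_mono) auto
  also have "\<dots> \<le> (1 + \<rho> + 2 * \<epsilon> * \<rho>) * (a + (1 / 2 - \<epsilon>) * m)"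
  proof -
    have "0 \<le> (\<rho> - 1 + 2 * \<epsilon> + 2 * \<epsilon> * \<rho>) * (a - m / 2)"
      using rho eps a by (intro mult_nonneg_nonneg) auto
    then show ?thesis by (simp add: algebra_simps)
  qed
  also have "\<dots> \<le> (1 + \<rho> + 2 * \<epsilon> * \<rho>) * (T *v x) $ k"
    using low rho eps by (intro mult_left_mono) auto
  finally show ?thesis .
qed

section \<open>Positive scalings to a doubly stochastic matrix\<close>

text \<open>
  Let \<open>\<rho>\<close> be the largest of the entry ratios of \<open>x\<close> and of \<open>y\<close>. It is attained, say in \<open>y\<close>; as \<open>y\<close>
  is the entrywise inverse of \<open>T x\<close>, the contraction bounds it by \<open>(1 + \<rho> + 2 \<epsilon> \<rho>) / (2 - 2 \<epsilon>)\<close>,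
  because \<open>\<rho>\<close> also bounds the ratios of \<open>x\<close>. The case of \<open>x\<close> is the same for the transpose.
\<close>

lemma scaling_entry_ratio:
  fixes T :: "real ^ 'n ^ 'n" and x y :: "real ^ 'n"
  assumes lower: "\<And>i j. 1 / (2 * real CARD('n)) \<le> T $ i $ j"
    and rows: "\<And>i. \<bar>(T *v 1) $ i - 1\<bar> \<le> \<epsilon>"
    and cols: "\<And>j. \<bar>(transpose T *v 1) $ j - 1\<bar> \<le> \<epsilon>"
    and x: "\<And>j. 0 < x $ j" and y: "\<And>i. 0 < y $ i"
    and Tx: "\<And>i. y $ i * (T *v x) $ i = 1"
    and Ty: "\<And>j. x $ j * (transpose T *v y) $ j = 1"
    and eps: "4 * \<epsilon> \<le> 1"
  shows "(1 - 4 * \<epsilon>) * x $ j \<le> x $ l"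
proof -
  define S where "S = (\<lambda>(j, l). x $ j / x $ l) ` UNIV \<union> (\<lambda>(j, l). y $ j / y $ l) ` UNIV"
  define \<rho> where "\<rho> = Max S"
  have S: "finite S" "S \<noteq> {}" by (auto simp: S_def)
  have ratios: "x $ j / x $ l \<le> \<rho>" "y $ j / y $ l \<le> \<rho>" for j l
    unfolding \<rho>_def by (rule Max_ge[OF S(1)]; force simp: S_def)+
  have ratio_x: "x $ j \<le> \<rho> * x $ l" and ratio_y: "y $ j \<le> \<rho> * y $ l" for j l
    using ratios[of j l] x[of l] y[of l] by (simp_all add: pos_divide_le_eq)
  have step: "(2 - 2 * \<epsilon>) * (v $ k / v $ i) \<le> 1 + \<rho> + 2 * \<epsilon> * \<rho>"
    if "(2 - 2 * \<epsilon>) * w $ i \<le> (1 + \<rho> + 2 * \<epsilon> * \<rho>) * w $ k"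
      and v: "\<And>j. 0 < v $ j" and inverse: "\<And>j. v $ j * w $ j = 1" for v w :: "real ^ 'n" and i k
  proof -
    have w: "w $ j = 1 / v $ j" for j
      using inverse[of j] v[of j] by (simp add: field_simps)
    show ?thesis
      using that(1) v[of k] v[of i] by (simp add: w field_simps)
  qed
  have "\<rho> \<in> S"
    unfolding \<rho>_def using S by (rule Max_in)
  then have "(2 - 2 * \<epsilon>) * \<rho> \<le> 1 + \<rho> + 2 * \<epsilon> * \<rho>"
    unfolding S_def
  proof (elim UnE imageE, goal_cases)
    case (1 p)
    obtain k i where "p = (k, i)" by force
    moreover have "(2 - 2 * \<epsilon>) * (x $ k / x $ i) \<le> 1 + \<rho> + 2 * \<epsilon> * \<rho>"
    proof (rule step[OF entry_ratio_contraction x Ty])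
      show "1 / (2 * real CARD('n)) \<le> transpose T $ i $ j" for i j
        using lower by (simp add: transpose_def)
      show "\<epsilon> \<le> 1" using eps by linarith
    qed (rule cols y ratio_y)+
    ultimately show ?case using 1 by simp
  next
    case (2 p)
    obtain k i where "p = (k, i)" by force
    moreover have "(2 - 2 * \<epsilon>) * (y $ k / y $ i) \<le> 1 + \<rho> + 2 * \<epsilon> * \<rho>"
      by (rule step[OF entry_ratio_contraction[OF lower rows x ratio_x] y Tx]) (use eps in linarith)
    ultimately show ?case using 2 by simp
  qed
  then have rho: "(1 - 4 * \<epsilon>) * \<rho> \<le> 1" by (simp add: algebra_simps)
  have "(1 - 4 * \<epsilon>) * x $ j \<le> (1 - 4 * \<epsilon>) * (\<rho> * x $ l)"
    using eps ratio_x by (intro mult_left_mono) auto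
  also have "\<dots> \<le> 1 * x $ l"
    unfolding mult.assoc[symmetric] using rho x[of l] by (intro mult_right_mono) auto
  finally show ?thesis by simp
qed

text \<open>
  Comparing every entry of \<open>x\<close> with the fixed entry \<open>x\<^sub>j\<close> turns \<open>y\<^sub>i (T x)\<^sub>i = 1\<close> into
  \<open>(1 - 4 \<epsilon>) (1 - \<epsilon>) y\<^sub>i x\<^sub>j \<le> 1\<close> and \<open>1 - 4 \<epsilon> \<le> (1 + \<epsilon>) y\<^sub>i x\<^sub>j\<close>.
\<close>

lemma scaling_product_near_one:
  fixes T :: "real ^ 'n ^ 'n" and x y :: "real ^ 'n"
  assumes lower: "\<And>i j. 1 / (2 * real CARD('n)) \<le> T $ i $ j"
    and rows: "\<And>i. \<bar>(T *v 1) $ i - 1\<bar> \<le> \<epsilon>"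
    and cols: "\<And>j. \<bar>(transpose T *v 1) $ j - 1\<bar> \<le> \<epsilon>"
    and x: "\<And>j. 0 < x $ j" and y: "\<And>i. 0 < y $ i"
    and Tx: "\<And>i. y $ i * (T *v x) $ i = 1"
    and Ty: "\<And>j. x $ j * (transpose T *v y) $ j = 1"
    and eps: "48 * \<epsilon> \<le> 1"
  shows "\<bar>y $ i * x $ j - 1\<bar> \<le> 6 * \<epsilon>"
proof -
  have near: "(1 - 4 * \<epsilon>) * x $ j \<le> x $ l" for j l
    using eps by (intro scaling_entry_ratio[OF lower rows cols x y Tx Ty]) auto
  have eps0: "0 \<le> \<epsilon>" using rows[of i] by linarith
  have T0: "0 \<le> T $ i $ l" for l
    using lower[of i l] by (rule order_trans[rotated]) simp
  define z where "z = y $ i * x $ j"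
  have z: "0 < z" by (simp add: z_def x y)
  have row_sum: "(T *v 1) $ i = (\<Sum>l\<in>UNIV. T $ i $ l)"
    by (simp add: matrix_vector_mult_def)
  have "(1 - 4 * \<epsilon>) * ((1 - \<epsilon>) * z) \<le> 1"
  proof -
    have "(1 - \<epsilon>) * ((1 - 4 * \<epsilon>) * x $ j) \<le> (T *v 1) $ i * ((1 - 4 * \<epsilon>) * x $ j)"
      using rows[of i] eps x[of j] by (intro mult_right_mono) auto
    also have "\<dots> = (\<Sum>l\<in>UNIV. T $ i $ l * ((1 - 4 * \<epsilon>) * x $ j))"
      by (simp only: row_sum sum_distrib_right)
    also have "\<dots> \<le> (T *v x) $ i"
      unfolding matrix_vector_mult_def by (auto intro!: sum_mono mult_left_mono T0 near)
    finally have "y $ i * ((1 - \<epsilon>) * ((1 - 4 * \<epsilon>) * x $ j)) \<le> y $ i * (T *v x) $ i"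
      using y[of i] by (intro mult_left_mono) auto
    then show ?thesis by (simp add: Tx z_def mult_ac)
  qed
  moreover have "(1 - 4 * \<epsilon>) \<le> (1 + \<epsilon>) * z"
  proof -
    have "(1 - 4 * \<epsilon>) * (T *v x) $ i = (\<Sum>l\<in>UNIV. T $ i $ l * ((1 - 4 * \<epsilon>) * x $ l))"
      by (simp add: matrix_vector_mult_def sum_distrib_left mult_ac)
    also have "\<dots> \<le> (\<Sum>l\<in>UNIV. T $ i $ l * x $ j)"
      by (intro sum_mono mult_left_mono T0 near)
    also have "\<dots> = (T *v 1) $ i * x $ j"
      by (simp only: row_sum sum_distrib_right)
    also have "\<dots> \<le> (1 + \<epsilon>) * x $ j"
      using rows[of i] x[of j] by (intro mult_right_mono) auto
    finally have "y $ i * ((1 - 4 * \<epsilon>) * (T *v x) $ i) \<le> y $ i * ((1 + \<epsilon>) * x $ j)"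
      using y[of i] by (intro mult_left_mono) auto
    moreover have "y $ i * ((1 - 4 * \<epsilon>) * (T *v x) $ i) = 1 - 4 * \<epsilon>"
      using Tx[of i] by (simp only: mult.left_commute[of "y $ i"] mult_1_right)
    ultimately have "1 - 4 * \<epsilon> \<le> y $ i * ((1 + \<epsilon>) * x $ j)" by (simp only:)
    then show ?thesis by (simp only: z_def mult_ac)
  qed
  moreover have "z \<le> 1 + 6 * \<epsilon>"
  proof -
    have "(1 - 5 * \<epsilon>) * z \<le> (1 - 4 * \<epsilon>) * ((1 - \<epsilon>) * z)"
      using z eps0 by (simp add: algebra_simps)
    also have "\<dots> \<le> 1" by fact
    also have "1 \<le> (1 - 5 * \<epsilon>) * (1 + 6 * \<epsilon>)"
    proof -
      have "0 \<le> \<epsilon> * (1 - 30 * \<epsilon>)" using eps eps0 by (intro mult_nonneg_nonneg) auto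
      then show ?thesis by (simp add: algebra_simps)
    qed
    finally show ?thesis using eps by simp
  qed
  moreover have "1 - 6 * \<epsilon> \<le> z"
  proof -
    have "(1 + \<epsilon>) * (1 - 6 * \<epsilon>) \<le> 1 - 4 * \<epsilon>"
      using eps0 by (simp add: algebra_simps)
    also have "\<dots> \<le> (1 + \<epsilon>) * z" by fact
    finally show ?thesis using eps0 by simp
  qed
  ultimately show ?thesis by (simp add: z_def)
qed

section \<open>Diagonal scalings\<close>

lemma diagonal_scaling_entry:
  fixes A B T :: "real ^ 'n ^ 'n"
  assumes "diagonal A" and "diagonal B"
  shows "(A ** T ** B) $ i $ j = A $ i $ i * T $ i $ j * B $ j $ j"
proof -
  have left: "(A ** T) $ i $ l = A $ i $ i * T $ i $ l" for l
  proof -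
    have "(A ** T) $ i $ l = (\<Sum>k\<in>UNIV. if k = i then A $ i $ i * T $ i $ l else 0)"
      unfolding matrix_matrix_mult_def vec_lambda_beta
      using \<open>diagonal A\<close> by (intro sum.cong) (auto simp: diagonal_def)
    then show ?thesis by simp
  qed
  have "(A ** T ** B) $ i $ j = (\<Sum>l\<in>UNIV. (A ** T) $ i $ l * B $ l $ j)"
    by (simp add: matrix_matrix_mult_def)
  also have "\<dots> = (\<Sum>l\<in>UNIV. if l = j then A $ i $ i * T $ i $ j * B $ j $ j else 0)"
    using \<open>diagonal B\<close> by (intro sum.cong) (auto simp: diagonal_def left)
  finally show ?thesis by simp
qed

text \<open>
  Nonnegativity leaves \<open>D\<^sub>1\<close> and \<open>D\<^sub>2\<close> a common sign, which cancels in the products of their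
  entries; passing to absolute values removes it without distinguishing cases.
\<close>

lemma diagonal_scaling_product_near_one:
  fixes T D\<^sub>1 D\<^sub>2 :: "real ^ 'n ^ 'n"
  assumes lower: "\<And>i j. 1 / (2 * real CARD('n)) \<le> T $ i $ j"
    and rows: "\<And>i. \<bar>(T *v 1) $ i - 1\<bar> \<le> \<epsilon>"
    and cols: "\<And>j. \<bar>(transpose T *v 1) $ j - 1\<bar> \<le> \<epsilon>"
    and eps: "48 * \<epsilon> \<le> 1"
    and D: "diagonal D\<^sub>1" "diagonal D\<^sub>2"
    and ds: "doubly_stochastic (D\<^sub>2 ** T ** D\<^sub>1)"
  shows "\<bar>D\<^sub>2 $ i $ i * D\<^sub>1 $ j $ j - 1\<bar> \<le> 6 * \<epsilon>"
proof -
  define x where "x = (\<chi> j. \<bar>D\<^sub>1 $ j $ j\<bar>)"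
  define y where "y = (\<chi> i. \<bar>D\<^sub>2 $ i $ i\<bar>)"
  have T: "0 < T $ i $ j" for i j
    by (rule less_le_trans[OF _ lower]) simp
  have entry: "(D\<^sub>2 ** T ** D\<^sub>1) $ i $ j = D\<^sub>2 $ i $ i * T $ i $ j * D\<^sub>1 $ j $ j" for i j
    by (rule diagonal_scaling_entry[OF D(2,1)])
  have nonneg: "0 \<le> D\<^sub>2 $ i $ i * T $ i $ j * D\<^sub>1 $ j $ j"
    and row: "(\<Sum>j\<in>UNIV. D\<^sub>2 $ i $ i * T $ i $ j * D\<^sub>1 $ j $ j) = 1"
    and col: "(\<Sum>i\<in>UNIV. D\<^sub>2 $ i $ i * T $ i $ j * D\<^sub>1 $ j $ j) = 1" for i j
    using ds by (simp_all add: doubly_stochastic_def entry)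
  have product: "y $ i * x $ j = D\<^sub>2 $ i $ i * D\<^sub>1 $ j $ j" for i j
  proof -
    have "0 \<le> T $ i $ j * (D\<^sub>2 $ i $ i * D\<^sub>1 $ j $ j)"
      using nonneg[of i j] by (simp add: mult_ac)
    then have "0 \<le> D\<^sub>2 $ i $ i * D\<^sub>1 $ j $ j"
      using T[of i j] by (simp add: zero_le_mult_iff)
    then show ?thesis
      by (simp add: x_def y_def abs_mult[symmetric])
  qed
  have summand: "T $ i $ j * (y $ i * x $ j) = D\<^sub>2 $ i $ i * T $ i $ j * D\<^sub>1 $ j $ j" for i j
    by (simp add: product)
  have x: "0 < x $ j" for j
    using col[of j] by (auto simp: x_def)
  have y: "0 < y $ i" for i
    using row[of i] by (auto simp: y_def)
  have Tx: "y $ i * (T *v x) $ i = 1" for i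
  proof -
    have "y $ i * (T *v x) $ i = (\<Sum>j\<in>UNIV. T $ i $ j * (y $ i * x $ j))"
      by (simp add: matrix_vector_mult_def sum_distrib_left mult_ac)
    also have "\<dots> = 1"
      by (simp only: summand row)
    finally show ?thesis .
  qed
  have Ty: "x $ j * (transpose T *v y) $ j = 1" for j
  proof -
    have "x $ j * (transpose T *v y) $ j = (\<Sum>i\<in>UNIV. T $ i $ j * (y $ i * x $ j))"
      by (simp add: matrix_vector_mult_def transpose_def sum_distrib_left mult_ac)
    also have "\<dots> = 1"
      by (simp only: summand col)
    finally show ?thesis .
  qed
  show ?thesis
    using scaling_product_near_one[OF lower rows cols x y Tx Ty eps, of i j]
    by (simp add: product)
qed

theorem proposition18:
  fixes T D\<^sub>1 D\<^sub>2 :: "real ^ 'n ^ 'n" and \<epsilon> :: real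
  assumes entries: "\<And>i j. \<bar>axis i 1 \<bullet> (T *v axis j 1) - 1 / real CARD('n)\<bar> \<le> 1 / (2 * real CARD('n))"
    and eps_def: "\<epsilon> = max (infnorm (T *v 1 - 1)) (infnorm (transpose T *v 1 - 1))"
    and eps_le: "\<epsilon> \<le> 1 / (48 * sqrt (real CARD('n)))"
    and "diagonal D\<^sub>1" and "diagonal D\<^sub>2"
    and "doubly_stochastic (D\<^sub>2 ** T ** D\<^sub>1)"
  shows "spectral_norm (D\<^sub>2 \<otimes>\<^sub>K D\<^sub>1 - mat 1) \<le> 96 * sqrt (real CARD('n)) * \<epsilon>"
proof -
  define q where "q = real CARD('n)"
  have q: "1 \<le> sqrt q" by (simp add: q_def Suc_leI)
  have lower: "1 / (2 * real CARD('n)) \<le> T $ i $ j" for i j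
  proof -
    have "axis i 1 \<bullet> (T *v axis j 1) = T $ i $ j"
      by (simp add: inner_axis' matrix_vector_mul_component inner_axis)
    moreover have "1 / real CARD('n) = 2 * (1 / (2 * real CARD('n)))"
      by simp
    ultimately show ?thesis
      using entries[of i j] by linarith
  qed
  have rows: "\<bar>(T *v 1) $ i - 1\<bar> \<le> \<epsilon>" and cols: "\<bar>(transpose T *v 1) $ i - 1\<bar> \<le> \<epsilon>" for i
    using component_le_infnorm_cart[of "T *v 1 - 1" i]
      component_le_infnorm_cart[of "transpose T *v 1 - 1" i]
    by (simp_all add: eps_def)
  have eps0: "0 \<le> \<epsilon>" using rows[of undefined] by linarith
  have "48 * \<epsilon> * 1 \<le> 48 * \<epsilon> * sqrt q"
    using q eps0 by (intro mult_left_mono) auto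
  also have "\<dots> \<le> 1"
    using eps_le q by (simp add: q_def field_simps)
  finally have eps: "48 * \<epsilon> \<le> 1" by simp
  have "spectral_norm (D\<^sub>2 \<otimes>\<^sub>K D\<^sub>1 - mat 1) \<le> 6 * \<epsilon>"
  proof (rule spectral_norm_diagonal_le)
    show "diagonal (D\<^sub>2 \<otimes>\<^sub>K D\<^sub>1 - mat 1)"
      using \<open>diagonal D\<^sub>1\<close> \<open>diagonal D\<^sub>2\<close>
      by (auto simp: diagonal_def kronecker_def mat_def prod_eq_iff)
    show "\<bar>(D\<^sub>2 \<otimes>\<^sub>K D\<^sub>1 - mat 1) $ p $ p\<bar> \<le> 6 * \<epsilon>" for p
      using diagonal_scaling_product_near_one[OF lower rows cols eps assms(4-6), of "fst p" "snd p"]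
      by (simp add: kronecker_def mat_def)
  qed
  also have "\<dots> \<le> (96 * sqrt q) * \<epsilon>"
    using q eps0 by (intro mult_right_mono) linarith+
  finally show ?thesis by (simp add: q_def)
qed

end
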